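(* Let $\mathcal{M}$ be a closed model category in the sense of Quillen. (1) Let $p:X\to Y$ be a map in $\mathcal{M}$ between fibrant objects. Then $p$ is a weak equivalence in $\mathcal{M}$ if and only if $p$ has the right HELP with respect to every cofibration of $\mathcal{M}$. (2) Let $i:A\to B$ be a map in $\mathcal{M}$ between cofibrant objects. Then $i$ is a weak equivalence in $\mathcal{M}$ if and only if $i$ has the left HELP with respect to every fibration of $\mathcal{M}$.
   Context: HELP stands for "homotopy extension lifting property". Let $i:A\to B$ and $p:X\to Y$ be maps in $\mathcal{M}$. Path objects and right homotopies. A path object for $Y$ is an object $Y^I$ together with a factorization $Y\xrightarrow{j}Y^I\xrightarrow{\pi}Y\times Y$ of the diagonal in which $j$ is a weak equivalence and $\pi$ is a fibration. A right homotopy (with respect to this path object) from $a:C\to Y$ to $b:C\to Y$ is a map $h:C\to Y^I$ with $\pi\circ h=(a,b)$. Cylinder objects and left homotopies. A cylinder object for $A$ is an object $Z_A$ together with a factorization $A\sqcup A\xrightarrow{j}Z_A\xrightarrow{\sigma}A$ of the fold map in which $j$ is a cofibration and $\sigma$ is a weak equivalence. A left homotopy (with respect to this cylinder object) from $a:A\to C$ to $b:A\to C$ is a map $h:Z_A\to C$ such that $h\circ j:A\sqcup A\to C$ is $a$ on the first summand and $b$ on the second. Right HELP. The map $p$ has the right HELP with respect to $i$ if for all maps $f_A:A\to X$ and $g:B\to Y$ (the square formed by $f_A,i,p,g$ is not required to commute) and each right homotopy $h_A:A\to Y^I$ from $p\circ f_A$ to $g\circ i$, where $Y^I$ is a path object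 for $Y$, there are a map $f:B\to X$ and a right homotopy $h:B\to Y^I$ (with respect to the same path object) from $p\circ f$ to $g$ such that $f\circ i=f_A$ and $h\circ i=h_A$. Left HELP. The map $i$ has the left HELP with respect to $p$ if for all maps $f:A\to X$ and $g_Y:B\to Y$ (the square formed by $f,i,p,g_Y$ is not required to commute) and each left homotopy $h_Y:Z_A\to Y$ from $g_Y\circ i$ to $p\circ f$, where $Z_A$ is a cylinder object for $A$, there are a map $g:B\to X$ and a left homotopy $h:Z_A\to X$ (with respect to the same cylinder object) from $g\circ i$ to $f$ such that $p\circ g=g_Y$ and $p\circ h=h_Y$. *)

theory Defs
  imports Main
begin

section \<open>Categories\<close>

record ('o, 'm) category =
  Obj :: "'o set"
  Mor :: "'m set"
  Dom :: "'m \<Rightarrow> 'o"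
  Cod :: "'m \<Rightarrow> 'o"
  Id :: "'o \<Rightarrow> 'm"
  Comp :: "'m \<Rightarrow> 'm \<Rightarrow> 'm"  (infixl "\<cdot>\<index>" 70)

text \<open>Composition is in applicative order: \<open>g \<cdot> f\<close> is \<open>f\<close> followed by \<open>g\<close>.
  It is meaningful only if \<open>Cod f = Dom g\<close>.\<close>

definition hom :: "('o, 'm, 'x) category_scheme \<Rightarrow> 'o \<Rightarrow> 'o \<Rightarrow> 'm set" where
  "hom C X Y = {f \<in> Mor C. Dom C f = X \<and> Cod C f = Y}"

locale category =
  fixes C :: "('o, 'm, 'x) category_scheme" (structure)
  assumes Dom_in_Obj: "f \<in> Mor C \<Longrightarrow> Dom C f \<in> Obj C"
    and Cod_in_Obj: "f \<in> Mor C \<Longrightarrow> Cod C f \<in> Obj C"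
    and Id_in_hom: "X \<in> Obj C \<Longrightarrow> Id C X \<in> hom C X X"
    and Comp_in_hom: "\<lbrakk>f \<in> hom C X Y; g \<in> hom C Y Z\<rbrakk> \<Longrightarrow> g \<cdot> f \<in> hom C X Z"
    and Id_right: "f \<in> hom C X Y \<Longrightarrow> f \<cdot> Id C X = f"
    and Id_left: "f \<in> hom C X Y \<Longrightarrow> Id C Y \<cdot> f = f"
    and Comp_assoc: "\<lbrakk>f \<in> hom C W X; g \<in> hom C X Y; h \<in> hom C Y Z\<rbrakk>
      \<Longrightarrow> (h \<cdot> g) \<cdot> f = h \<cdot> (g \<cdot> f)"


section \<open>Finite limits and colimits\<close>

definition is_functor ::
  "('i, 'j, 'x) category_scheme \<Rightarrow> ('o, 'm, 'y) category_scheme \<Rightarrow> ('i \<Rightarrow> 'o) \<Rightarrow> ('j \<Rightarrow> 'm) \<Rightarrow> bool" where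
  "is_functor J C F\<^sub>o F\<^sub>m \<longleftrightarrow>
     category J \<and> category C \<and>
     (\<forall>x \<in> Obj J. F\<^sub>o x \<in> Obj C) \<and>
     (\<forall>u \<in> Mor J. F\<^sub>m u \<in> hom C (F\<^sub>o (Dom J u)) (F\<^sub>o (Cod J u))) \<and>
     (\<forall>x \<in> Obj J. F\<^sub>m (Id J x) = Id C (F\<^sub>o x)) \<and>
     (\<forall>u \<in> Mor J. \<forall>v \<in> Mor J. Cod J u = Dom J v \<longrightarrow> F\<^sub>m (v \<cdot>\<^bsub>J\<^esub> u) = F\<^sub>m v \<cdot>\<^bsub>C\<^esub> F\<^sub>m u)"

definition is_cone ::
  "('i, 'j, 'x) category_scheme \<Rightarrow> ('o, 'm, 'y) category_scheme \<Rightarrow> ('i \<Rightarrow> 'o) \<Rightarrow> ('j \<Rightarrow> 'm)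
    \<Rightarrow> 'o \<Rightarrow> ('i \<Rightarrow> 'm) \<Rightarrow> bool" where
  "is_cone J C F\<^sub>o F\<^sub>m L c \<longleftrightarrow>
     L \<in> Obj C \<and>
     (\<forall>x \<in> Obj J. c x \<in> hom C L (F\<^sub>o x)) \<and>
     (\<forall>u \<in> Mor J. F\<^sub>m u \<cdot>\<^bsub>C\<^esub> c (Dom J u) = c (Cod J u))"

definition is_limit ::
  "('i, 'j, 'x) category_scheme \<Rightarrow> ('o, 'm, 'y) category_scheme \<Rightarrow> ('i \<Rightarrow> 'o) \<Rightarrow> ('j \<Rightarrow> 'm)
    \<Rightarrow> 'o \<Rightarrow> ('i \<Rightarrow> 'm) \<Rightarrow> bool" where
  "is_limit J C F\<^sub>o F\<^sub>m L c \<longleftrightarrow>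
     is_cone J C F\<^sub>o F\<^sub>m L c \<and>
     (\<forall>L' c'. is_cone J C F\<^sub>o F\<^sub>m L' c' \<longrightarrow>
        (\<exists>!u. u \<in> hom C L' L \<and> (\<forall>x \<in> Obj J. c x \<cdot>\<^bsub>C\<^esub> u = c' x)))"

definition is_cocone ::
  "('i, 'j, 'x) category_scheme \<Rightarrow> ('o, 'm, 'y) category_scheme \<Rightarrow> ('i \<Rightarrow> 'o) \<Rightarrow> ('j \<Rightarrow> 'm)
    \<Rightarrow> 'o \<Rightarrow> ('i \<Rightarrow> 'm) \<Rightarrow> bool" where
  "is_cocone J C F\<^sub>o F\<^sub>m L c \<longleftrightarrow>
     L \<in> Obj C \<and>
     (\<forall>x \<in> Obj J. c x \<in> hom C (F\<^sub>o x) L) \<and>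
     (\<forall>u \<in> Mor J. c (Cod J u) \<cdot>\<^bsub>C\<^esub> F\<^sub>m u = c (Dom J u))"

definition is_colimit ::
  "('i, 'j, 'x) category_scheme \<Rightarrow> ('o, 'm, 'y) category_scheme \<Rightarrow> ('i \<Rightarrow> 'o) \<Rightarrow> ('j \<Rightarrow> 'm)
    \<Rightarrow> 'o \<Rightarrow> ('i \<Rightarrow> 'm) \<Rightarrow> bool" where
  "is_colimit J C F\<^sub>o F\<^sub>m L c \<longleftrightarrow>
     is_cocone J C F\<^sub>o F\<^sub>m L c \<and>
     (\<forall>L' c'. is_cocone J C F\<^sub>o F\<^sub>m L' c' \<longrightarrow>
        (\<exists>!u. u \<in> hom C L L' \<and> (\<forall>x \<in> Obj J. u \<cdot>\<^bsub>C\<^esub> c x = c' x)))"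

text \<open>Every finite category is isomorphic to one whose objects and morphisms are natural numbers,
  so it is no restriction to let the shape of a finite diagram be of type \<open>(nat, nat) category\<close>.\<close>

definition has_finite_limits :: "('o, 'm, 'x) category_scheme \<Rightarrow> bool" where
  "has_finite_limits C \<longleftrightarrow>
     (\<forall>(J :: (nat, nat) category) F\<^sub>o F\<^sub>m.
        finite (Obj J) \<and> finite (Mor J) \<and> is_functor J C F\<^sub>o F\<^sub>m \<longrightarrow>
        (\<exists>L c. is_limit J C F\<^sub>o F\<^sub>m L c))"

definition has_finite_colimits :: "('o, 'm, 'x) category_scheme \<Rightarrow> bool" where
  "has_finite_colimits C \<longleftrightarrow>
     (\<forall>(J :: (nat, nat) category) F\<^sub>o F\<^sub>m.
        finite (Obj J) \<and> finite (Mor J) \<and> is_functor J C F\<^sub>o F\<^sub>m \<longrightarrow>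
        (\<exists>L c. is_colimit J C F\<^sub>o F\<^sub>m L c))"

definition is_terminal :: "('o, 'm, 'x) category_scheme \<Rightarrow> 'o \<Rightarrow> bool" where
  "is_terminal C T \<longleftrightarrow> T \<in> Obj C \<and> (\<forall>X \<in> Obj C. \<exists>!t. t \<in> hom C X T)"

definition is_initial :: "('o, 'm, 'x) category_scheme \<Rightarrow> 'o \<Rightarrow> bool" where
  "is_initial C E \<longleftrightarrow> E \<in> Obj C \<and> (\<forall>X \<in> Obj C. \<exists>!t. t \<in> hom C E X)"

definition is_product ::
  "('o, 'm, 'x) category_scheme \<Rightarrow> 'o \<Rightarrow> 'o \<Rightarrow> 'o \<Rightarrow> 'm \<Rightarrow> 'm \<Rightarrow> bool" where
  "is_product C X Y P q\<^sub>0 q\<^sub>1 \<longleftrightarrow>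
     q\<^sub>0 \<in> hom C P X \<and> q\<^sub>1 \<in> hom C P Y \<and>
     (\<forall>W a b. a \<in> hom C W X \<and> b \<in> hom C W Y \<longrightarrow>
        (\<exists>!u. u \<in> hom C W P \<and> q\<^sub>0 \<cdot>\<^bsub>C\<^esub> u = a \<and> q\<^sub>1 \<cdot>\<^bsub>C\<^esub> u = b))"

definition is_coproduct ::
  "('o, 'm, 'x) category_scheme \<Rightarrow> 'o \<Rightarrow> 'o \<Rightarrow> 'o \<Rightarrow> 'm \<Rightarrow> 'm \<Rightarrow> bool" where
  "is_coproduct C X Y S e\<^sub>0 e\<^sub>1 \<longleftrightarrow>
     e\<^sub>0 \<in> hom C X S \<and> e\<^sub>1 \<in> hom C Y S \<and>
     (\<forall>W a b. a \<in> hom C X W \<and> b \<in> hom C Y W \<longrightarrow>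
        (\<exists>!u. u \<in> hom C S W \<and> u \<cdot>\<^bsub>C\<^esub> e\<^sub>0 = a \<and> u \<cdot>\<^bsub>C\<^esub> e\<^sub>1 = b))"

text \<open>The map \<open>(a, b)\<close> into the product \<open>P\<close> with projections \<open>q\<^sub>0\<close>, \<open>q\<^sub>1\<close>, and the map out of the
  coproduct \<open>S\<close> with injections \<open>e\<^sub>0\<close>, \<open>e\<^sub>1\<close> that is \<open>a\<close> and \<open>b\<close> on the two summands.\<close>

definition pairing ::
  "('o, 'm, 'x) category_scheme \<Rightarrow> 'o \<Rightarrow> 'm \<Rightarrow> 'm \<Rightarrow> 'm \<Rightarrow> 'm \<Rightarrow> 'm" where
  "pairing C P q\<^sub>0 q\<^sub>1 a b =
     (THE u. u \<in> hom C (Dom C a) P \<and> q\<^sub>0 \<cdot>\<^bsub>C\<^esub> u = a \<and> q\<^sub>1 \<cdot>\<^bsub>C\<^esub> u = b)"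

definition copairing ::
  "('o, 'm, 'x) category_scheme \<Rightarrow> 'o \<Rightarrow> 'm \<Rightarrow> 'm \<Rightarrow> 'm \<Rightarrow> 'm \<Rightarrow> 'm" where
  "copairing C S e\<^sub>0 e\<^sub>1 a b =
     (THE u. u \<in> hom C S (Cod C a) \<and> u \<cdot>\<^bsub>C\<^esub> e\<^sub>0 = a \<and> u \<cdot>\<^bsub>C\<^esub> e\<^sub>1 = b)"


section \<open>Closed model categories\<close>

record ('o, 'm) model_category = "('o, 'm) category" +
  Fib :: "'m set"
  Cof :: "'m set"
  Weq :: "'m set"

definition is_retract :: "('o, 'm, 'x) category_scheme \<Rightarrow> 'm \<Rightarrow> 'm \<Rightarrow> bool" where
  "is_retract C f g \<longleftrightarrow>
     f \<in> Mor C \<and> g \<in> Mor C \<and>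
     (\<exists>s\<^sub>0 r\<^sub>0 s\<^sub>1 r\<^sub>1.
        s\<^sub>0 \<in> hom C (Dom C f) (Dom C g) \<and> r\<^sub>0 \<in> hom C (Dom C g) (Dom C f) \<and>
        s\<^sub>1 \<in> hom C (Cod C f) (Cod C g) \<and> r\<^sub>1 \<in> hom C (Cod C g) (Cod C f) \<and>
        r\<^sub>0 \<cdot>\<^bsub>C\<^esub> s\<^sub>0 = Id C (Dom C f) \<and> r\<^sub>1 \<cdot>\<^bsub>C\<^esub> s\<^sub>1 = Id C (Cod C f) \<and>
        g \<cdot>\<^bsub>C\<^esub> s\<^sub>0 = s\<^sub>1 \<cdot>\<^bsub>C\<^esub> f \<and> f \<cdot>\<^bsub>C\<^esub> r\<^sub>0 = r\<^sub>1 \<cdot>\<^bsub>C\<^esub> g)"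

definition has_lifts :: "('o, 'm, 'x) category_scheme \<Rightarrow> 'm \<Rightarrow> 'm \<Rightarrow> bool" where
  "has_lifts C i p \<longleftrightarrow>
     (\<forall>f \<in> hom C (Dom C i) (Dom C p). \<forall>g \<in> hom C (Cod C i) (Cod C p).
        p \<cdot>\<^bsub>C\<^esub> f = g \<cdot>\<^bsub>C\<^esub> i \<longrightarrow>
        (\<exists>h \<in> hom C (Cod C i) (Dom C p). h \<cdot>\<^bsub>C\<^esub> i = f \<and> p \<cdot>\<^bsub>C\<^esub> h = g))"

text \<open>The axioms CM1 to CM5 of Quillen, Rational homotopy theory, Annals of Mathematics 90 (1969).
  Only finite limits and colimits are required, and factorizations need not be functorial.\<close>

locale closed_model_category = category M
  for M :: "('o, 'm, 'x) model_category_scheme" (structure) +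
  assumes Fib_sub: "Fib M \<subseteq> Mor M"
    and Cof_sub: "Cof M \<subseteq> Mor M"
    and Weq_sub: "Weq M \<subseteq> Mor M"
    and CM1_limits: "has_finite_limits M"
    and CM1_colimits: "has_finite_colimits M"
    and CM2_comp: "\<lbrakk>f \<in> hom M X Y; g \<in> hom M Y Z; f \<in> Weq M; g \<in> Weq M\<rbrakk> \<Longrightarrow> g \<cdot> f \<in> Weq M"
    and CM2_left: "\<lbrakk>f \<in> hom M X Y; g \<in> hom M Y Z; f \<in> Weq M; g \<cdot> f \<in> Weq M\<rbrakk> \<Longrightarrow> g \<in> Weq M"
    and CM2_right: "\<lbrakk>f \<in> hom M X Y; g \<in> hom M Y Z; g \<in> Weq M; g \<cdot> f \<in> Weq M\<rbrakk> \<Longrightarrow> f \<in> Weq M"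
    and CM3_Fib: "\<lbrakk>is_retract M f g; g \<in> Fib M\<rbrakk> \<Longrightarrow> f \<in> Fib M"
    and CM3_Cof: "\<lbrakk>is_retract M f g; g \<in> Cof M\<rbrakk> \<Longrightarrow> f \<in> Cof M"
    and CM3_Weq: "\<lbrakk>is_retract M f g; g \<in> Weq M\<rbrakk> \<Longrightarrow> f \<in> Weq M"
    and CM4_trivial_Cof: "\<lbrakk>i \<in> Cof M; i \<in> Weq M; p \<in> Fib M\<rbrakk> \<Longrightarrow> has_lifts M i p"
    and CM4_trivial_Fib: "\<lbrakk>i \<in> Cof M; p \<in> Fib M; p \<in> Weq M\<rbrakk> \<Longrightarrow> has_lifts M i p"
    and CM5_trivial_Cof: "f \<in> hom M X Y \<Longrightarrow>
      \<exists>Z. \<exists>i \<in> hom M X Z. \<exists>p \<in> hom M Z Y. i \<in> Cof M \<and> i \<in> Weq M \<and> p \<in> Fib M \<and> f = p \<cdot> i"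
    and CM5_trivial_Fib: "f \<in> hom M X Y \<Longrightarrow>
      \<exists>Z. \<exists>i \<in> hom M X Z. \<exists>p \<in> hom M Z Y. i \<in> Cof M \<and> p \<in> Fib M \<and> p \<in> Weq M \<and> f = p \<cdot> i"

definition fibrant :: "('o, 'm, 'x) model_category_scheme \<Rightarrow> 'o \<Rightarrow> bool" where
  "fibrant M X \<longleftrightarrow> X \<in> Obj M \<and> (\<exists>T. is_terminal M T \<and> (\<exists>t \<in> hom M X T. t \<in> Fib M))"

definition cofibrant :: "('o, 'm, 'x) model_category_scheme \<Rightarrow> 'o \<Rightarrow> bool" where
  "cofibrant M X \<longleftrightarrow> X \<in> Obj M \<and> (\<exists>E. is_initial M E \<and> (\<exists>t \<in> hom M E X. t \<in> Cof M))"


section \<open>Homotopies and HELP\<close>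

text \<open>Products and coproducts are only determined up to isomorphism. A path object for \<open>Y\<close>
  therefore carries a product \<open>P\<close> of \<open>Y\<close> with itself, with projections \<open>q\<^sub>0\<close>, \<open>q\<^sub>1\<close>, and a cylinder
  object for \<open>A\<close> carries a coproduct \<open>S\<close> of \<open>A\<close> with itself, with injections \<open>e\<^sub>0\<close>, \<open>e\<^sub>1\<close>.\<close>

definition path_object ::
  "('o, 'm, 'x) model_category_scheme \<Rightarrow> 'o \<Rightarrow> 'o \<Rightarrow> 'm \<Rightarrow> 'm \<Rightarrow> 'o \<Rightarrow> 'm \<Rightarrow> 'm \<Rightarrow> bool" where
  "path_object M Y P q\<^sub>0 q\<^sub>1 YI j \<pi> \<longleftrightarrow>
     is_product M Y Y P q\<^sub>0 q\<^sub>1 \<and>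
     j \<in> hom M Y YI \<and> \<pi> \<in> hom M YI P \<and>
     \<pi> \<cdot>\<^bsub>M\<^esub> j = pairing M P q\<^sub>0 q\<^sub>1 (Id M Y) (Id M Y) \<and>
     j \<in> Weq M \<and> \<pi> \<in> Fib M"

text \<open>\<open>h\<close> is a right homotopy from \<open>a : C \<rightarrow> Y\<close> to \<open>b : C \<rightarrow> Y\<close>.\<close>

definition right_homotopy ::
  "('o, 'm, 'x) model_category_scheme \<Rightarrow> 'o \<Rightarrow> 'o \<Rightarrow> 'm \<Rightarrow> 'm \<Rightarrow> 'o \<Rightarrow> 'm
    \<Rightarrow> 'o \<Rightarrow> 'm \<Rightarrow> 'm \<Rightarrow> 'm \<Rightarrow> bool" where
  "right_homotopy M Y P q\<^sub>0 q\<^sub>1 YI \<pi> C a b h \<longleftrightarrow>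
     a \<in> hom M C Y \<and> b \<in> hom M C Y \<and> h \<in> hom M C YI \<and>
     \<pi> \<cdot>\<^bsub>M\<^esub> h = pairing M P q\<^sub>0 q\<^sub>1 a b"

definition cylinder_object ::
  "('o, 'm, 'x) model_category_scheme \<Rightarrow> 'o \<Rightarrow> 'o \<Rightarrow> 'm \<Rightarrow> 'm \<Rightarrow> 'o \<Rightarrow> 'm \<Rightarrow> 'm \<Rightarrow> bool" where
  "cylinder_object M A S e\<^sub>0 e\<^sub>1 Z j \<sigma> \<longleftrightarrow>
     is_coproduct M A A S e\<^sub>0 e\<^sub>1 \<and>
     j \<in> hom M S Z \<and> \<sigma> \<in> hom M Z A \<and>
     \<sigma> \<cdot>\<^bsub>M\<^esub> j = copairing M S e\<^sub>0 e\<^sub>1 (Id M A) (Id M A) \<and>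
     j \<in> Cof M \<and> \<sigma> \<in> Weq M"

text \<open>\<open>h\<close> is a left homotopy from \<open>a : A \<rightarrow> C\<close> to \<open>b : A \<rightarrow> C\<close>.\<close>

definition left_homotopy ::
  "('o, 'm, 'x) model_category_scheme \<Rightarrow> 'o \<Rightarrow> 'o \<Rightarrow> 'm \<Rightarrow> 'm \<Rightarrow> 'o \<Rightarrow> 'm
    \<Rightarrow> 'o \<Rightarrow> 'm \<Rightarrow> 'm \<Rightarrow> 'm \<Rightarrow> bool" where
  "left_homotopy M A S e\<^sub>0 e\<^sub>1 Z j C a b h \<longleftrightarrow>
     a \<in> hom M A C \<and> b \<in> hom M A C \<and> h \<in> hom M Z C \<and>
     h \<cdot>\<^bsub>M\<^esub> j = copairing M S e\<^sub>0 e\<^sub>1 a b"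

text \<open>In the next two definitions \<open>i : A \<rightarrow> B\<close> and \<open>p : X \<rightarrow> Y\<close>.\<close>

definition right_HELP :: "('o, 'm, 'x) model_category_scheme \<Rightarrow> 'm \<Rightarrow> 'm \<Rightarrow> bool" where
  "right_HELP M p i \<longleftrightarrow>
     (let A = Dom M i; B = Cod M i; X = Dom M p; Y = Cod M p in
      \<forall>f\<^sub>A g P q\<^sub>0 q\<^sub>1 YI j \<pi> h\<^sub>A.
        f\<^sub>A \<in> hom M A X \<and> g \<in> hom M B Y \<and>
        path_object M Y P q\<^sub>0 q\<^sub>1 YI j \<pi> \<and>
        right_homotopy M Y P q\<^sub>0 q\<^sub>1 YI \<pi> A (p \<cdot>\<^bsub>M\<^esub> f\<^sub>A) (g \<cdot>\<^bsub>M\<^esub> i) h\<^sub>A \<longrightarrow>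
        (\<exists>f h. f \<in> hom M B X \<and>
               right_homotopy M Y P q\<^sub>0 q\<^sub>1 YI \<pi> B (p \<cdot>\<^bsub>M\<^esub> f) g h \<and>
               f \<cdot>\<^bsub>M\<^esub> i = f\<^sub>A \<and> h \<cdot>\<^bsub>M\<^esub> i = h\<^sub>A))"

definition left_HELP :: "('o, 'm, 'x) model_category_scheme \<Rightarrow> 'm \<Rightarrow> 'm \<Rightarrow> bool" where
  "left_HELP M i p \<longleftrightarrow>
     (let A = Dom M i; B = Cod M i; X = Dom M p; Y = Cod M p in
      \<forall>f g\<^sub>Y S e\<^sub>0 e\<^sub>1 Z j \<sigma> h\<^sub>Y.
        f \<in> hom M A X \<and> g\<^sub>Y \<in> hom M B Y \<and>
        cylinder_object M A S e\<^sub>0 e\<^sub>1 Z j \<sigma> \<and>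
        left_homotopy M A S e\<^sub>0 e\<^sub>1 Z j Y (g\<^sub>Y \<cdot>\<^bsub>M\<^esub> i) (p \<cdot>\<^bsub>M\<^esub> f) h\<^sub>Y \<longrightarrow>
        (\<exists>g h. g \<in> hom M B X \<and>
               left_homotopy M A S e\<^sub>0 e\<^sub>1 Z j X (g \<cdot>\<^bsub>M\<^esub> i) f h \<and>
               p \<cdot>\<^bsub>M\<^esub> g = g\<^sub>Y \<and> p \<cdot>\<^bsub>M\<^esub> h = h\<^sub>Y))"

end

theory Submission
  imports Defs
begin

text \<open>For a path object \<open>Y\<^sup>I\<close> form the mapping path object \<open>N = X \<times>\<^sub>Y Y\<^sup>I\<close> with its end point map
  \<open>r : N \<rightarrow> Y\<close>. The data and the conclusion of right HELP for \<open>p\<close> with respect to \<open>i\<close> are exactly a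
  square from \<open>i\<close> to \<open>r\<close> and a diagonal lift of it. Since \<open>Y\<close> is fibrant, \<open>N \<rightarrow> X\<close> is a trivial
  fibration, so its section \<open>s : X \<rightarrow> N\<close> is a weak equivalence; since \<open>X\<close> is fibrant, \<open>r\<close> is a
  fibration. As \<open>p = r s\<close>, the map \<open>p\<close> is a weak equivalence iff \<open>r\<close> is a trivial fibration, that
  is, iff \<open>r\<close> has the right lifting property against all cofibrations. The second part is the
  first part in the opposite category.\<close>

section \<open>Pullbacks\<close>

definition is_pullback ::
  "('o, 'm, 'x) category_scheme \<Rightarrow> 'm \<Rightarrow> 'm \<Rightarrow> 'o \<Rightarrow> 'm \<Rightarrow> 'm \<Rightarrow> bool" where
  "is_pullback C a b L c d \<longleftrightarrow>
     c \<in> hom C L (Dom C a) \<and> d \<in> hom C L (Dom C b) \<and> a \<cdot>\<^bsub>C\<^esub> c = b \<cdot>\<^bsub>C\<^esub> d \<and>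
     (\<forall>W. \<forall>x \<in> hom C W (Dom C a). \<forall>y \<in> hom C W (Dom C b). a \<cdot>\<^bsub>C\<^esub> x = b \<cdot>\<^bsub>C\<^esub> y \<longrightarrow>
        (\<exists>!u. u \<in> hom C W L \<and> c \<cdot>\<^bsub>C\<^esub> u = x \<and> d \<cdot>\<^bsub>C\<^esub> u = y))"

text \<open>The shape \<open>0 \<rightarrow> 2 \<leftarrow> 1\<close>: the morphisms \<open>0, 1, 2\<close> are the identities, and \<open>3 : 0 \<rightarrow> 2\<close>,
  \<open>4 : 1 \<rightarrow> 2\<close>.\<close>

definition cospan :: "(nat, nat) category" where
  "cospan = \<lparr>Obj = {0, 1, 2}, Mor = {0, 1, 2, 3, 4},
     Dom = (\<lambda>u. if u = 3 then 0 else if u = 4 then 1 else u),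
     Cod = (\<lambda>u. if u = 3 \<or> u = 4 then 2 else u),
     Id = (\<lambda>x. x), Comp = (\<lambda>v u. if u < 3 then v else u)\<rparr>"

text \<open>Every composable pair contains an identity: a first arrow \<open>u\<close> that is not
  one ends in \<open>2\<close>, where only the identity starts. Hence the two cases of
  \<open>Comp\<close>.\<close>

lemma category_cospan: "category cospan"
  by unfold_locales (auto simp: cospan_def hom_def split: if_splits)

context category
begin

lemma homD: "f \<in> hom C X Y \<Longrightarrow> X \<in> Obj C" "f \<in> hom C X Y \<Longrightarrow> Y \<in> Obj C"
  by (auto simp: hom_def Dom_in_Obj Cod_in_Obj)

text \<open>CM1 speaks of finite diagrams only. The pullback is read off a limit over
  \<open>cospan\<close> by forgetting the leg at \<open>2\<close>, which the other legs
  determine.\<close>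

lemma pullback_exists:
  assumes lim: "has_finite_limits C"
    and a: "a \<in> hom C X Z" and b: "b \<in> hom C Y Z"
  shows "\<exists>L c d. is_pullback C a b L c d"
proof -
  define Fo where "Fo x = (if x = (0::nat) then X else if x = 1 then Y else Z)" for x
  define Fm where "Fm u = (if u = 3 then a else if u = 4 then b else Id C (Fo u))" for u :: nat
  have ob: "X \<in> Obj C" "Y \<in> Obj C" "Z \<in> Obj C"
    using homD a b by auto
  have idd: "Id C V \<cdot> Id C V = Id C V" if "V \<in> Obj C" for V
    using Id_in_hom[OF that] Id_left by blast
  have "is_functor cospan C Fo Fm"
    unfolding is_functor_def
    using ob a b category_cospan category_axioms
    by (auto simp: cospan_def Fo_def Fm_def Id_in_hom idd Id_left Id_right)
  moreover have "finite (Obj cospan)" "finite (Mor cospan)"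
    by (auto simp: cospan_def)
  ultimately obtain L l where L: "is_limit cospan C Fo Fm L l"
    using lim unfolding has_finite_limits_def by blast
  then have cone: "is_cone cospan C Fo Fm L l"
    by (simp add: is_limit_def)
  have l: "l 0 \<in> hom C L X" "l 1 \<in> hom C L Y" "a \<cdot> l 0 = l 2" "b \<cdot> l 1 = l 2"
    using cone by (auto simp: is_cone_def cospan_def Fo_def Fm_def)
  have DD: "Dom C a = X" "Dom C b = Y"
    using a b by (auto simp: hom_def)
  have "\<exists>!u. u \<in> hom C W L \<and> l 0 \<cdot> u = x \<and> l 1 \<cdot> u = y"
    if x: "x \<in> hom C W X" and y: "y \<in> hom C W Y" and xy: "a \<cdot> x = b \<cdot> y" for W x y
  proof -
    \<comment> \<open>The cone condition forces the leg at \<open>2\<close> to be the common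
      composite.\<close>
    define k where "k n = (if n = (0::nat) then x else if n = 1 then y else a \<cdot> x)" for n
    have ax: "a \<cdot> x \<in> hom C W Z" by (rule Comp_in_hom[OF x a])
    have "is_cone cospan C Fo Fm W k"
      using x y xy ax homD(1)[OF x]
      by (auto simp: is_cone_def cospan_def Fo_def Fm_def k_def Id_left)
    then have "\<exists>!u. u \<in> hom C W L \<and> (\<forall>n \<in> Obj cospan. l n \<cdot> u = k n)"
      using L by (simp add: is_limit_def)
    \<comment> \<open>The condition at \<open>2\<close> follows from the one at \<open>0\<close>
      because \<open>l 2 = a \<cdot> l 0\<close>.\<close>
    moreover have "(\<forall>n \<in> Obj cospan. l n \<cdot> u = k n) \<longleftrightarrow> l 0 \<cdot> u = x \<and> l 1 \<cdot> u = y"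
      if u: "u \<in> hom C W L" for u
      using Comp_assoc[OF u l(1) a] l(3) by (auto simp: cospan_def k_def)
    ultimately show ?thesis by (simp cong: conj_cong)
  qed
  with l DD have "is_pullback C a b L (l 0) (l 1)"
    by (simp add: is_pullback_def)
  then show ?thesis by blast
qed

section \<open>Pairings and binary products\<close>

lemma pairing_props:
  assumes "is_product C X Y P q\<^sub>0 q\<^sub>1" "a \<in> hom C W X" "b \<in> hom C W Y"
  shows "pairing C P q\<^sub>0 q\<^sub>1 a b \<in> hom C W P"
    and "q\<^sub>0 \<cdot> pairing C P q\<^sub>0 q\<^sub>1 a b = a" and "q\<^sub>1 \<cdot> pairing C P q\<^sub>0 q\<^sub>1 a b = b"
proof -
  have "Dom C a = W" using assms by (simp add: hom_def)
  moreover have "\<exists>!u. u \<in> hom C W P \<and> q\<^sub>0 \<cdot> u = a \<and> q\<^sub>1 \<cdot> u = b"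
    using assms unfolding is_product_def by blast
  ultimately have "pairing C P q\<^sub>0 q\<^sub>1 a b \<in> hom C W P \<and>
      q\<^sub>0 \<cdot> pairing C P q\<^sub>0 q\<^sub>1 a b = a \<and> q\<^sub>1 \<cdot> pairing C P q\<^sub>0 q\<^sub>1 a b = b"
    unfolding pairing_def using theI'[of "\<lambda>u. u \<in> hom C W P \<and> q\<^sub>0 \<cdot> u = a \<and> q\<^sub>1 \<cdot> u = b"] by simp
  then show "pairing C P q\<^sub>0 q\<^sub>1 a b \<in> hom C W P"
    and "q\<^sub>0 \<cdot> pairing C P q\<^sub>0 q\<^sub>1 a b = a" and "q\<^sub>1 \<cdot> pairing C P q\<^sub>0 q\<^sub>1 a b = b"
    by auto
qed

lemma eq_pairing_iff:
  assumes P: "is_product C X Y P q\<^sub>0 q\<^sub>1" and ab: "a \<in> hom C W X" "b \<in> hom C W Y"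
    and u: "u \<in> hom C W P"
  shows "u = pairing C P q\<^sub>0 q\<^sub>1 a b \<longleftrightarrow> q\<^sub>0 \<cdot> u = a \<and> q\<^sub>1 \<cdot> u = b"
proof -
  have "\<exists>!u. u \<in> hom C W P \<and> q\<^sub>0 \<cdot> u = a \<and> q\<^sub>1 \<cdot> u = b"
    using P ab unfolding is_product_def by blast
  then show ?thesis using pairing_props[OF P ab] u by blast
qed

text \<open>A product is a pullback over a terminal object, where every square commutes.\<close>

lemma product_exists:
  assumes lim: "has_finite_limits C" and T: "is_terminal C T"
    and X: "X \<in> Obj C" and Y: "Y \<in> Obj C"
  shows "\<exists>P q\<^sub>0 q\<^sub>1. is_product C X Y P q\<^sub>0 q\<^sub>1"
proof -
  obtain a b where a: "a \<in> hom C X T" and b: "b \<in> hom C Y T"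
    using T X Y unfolding is_terminal_def by blast
  obtain L c d where pb: "is_pullback C a b L c d"
    using pullback_exists[OF lim a b] by blast
  have D: "Dom C a = X" "Dom C b = Y" using a b by (auto simp: hom_def)
  have "a \<cdot> x = b \<cdot> y" if x: "x \<in> hom C W X" and y: "y \<in> hom C W Y" for W x y
    using Comp_in_hom[OF x a] Comp_in_hom[OF y b] T homD(1)[OF x]
    unfolding is_terminal_def by blast
  then have "is_product C X Y L c d"
    using pb unfolding is_product_def is_pullback_def D by blast
  then show ?thesis by blast
qed

end

section \<open>Lifting properties\<close>

lemma has_liftsD:
  assumes "has_lifts C i p" "i \<in> hom C A B" "p \<in> hom C X Y"
    "f \<in> hom C A X" "g \<in> hom C B Y" "p \<cdot>\<^bsub>C\<^esub> f = g \<cdot>\<^bsub>C\<^esub> i"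
  shows "\<exists>h \<in> hom C B X. h \<cdot>\<^bsub>C\<^esub> i = f \<and> p \<cdot>\<^bsub>C\<^esub> h = g"
  using assms by (simp add: has_lifts_def hom_def)

lemma has_liftsI:
  assumes "i \<in> hom C A B" "p \<in> hom C X Y"
    and "\<And>f g. \<lbrakk>f \<in> hom C A X; g \<in> hom C B Y; p \<cdot>\<^bsub>C\<^esub> f = g \<cdot>\<^bsub>C\<^esub> i\<rbrakk>
      \<Longrightarrow> \<exists>h \<in> hom C B X. h \<cdot>\<^bsub>C\<^esub> i = f \<and> p \<cdot>\<^bsub>C\<^esub> h = g"
  shows "has_lifts C i p"
  using assms by (simp add: has_lifts_def hom_def)

context category
begin

text \<open>The retract argument: a lift \<open>h\<close> in the square with top edge the identity
  of \<open>X\<close> and bottom edge \<open>p\<close> splits \<open>i\<close>, and the identity of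
  \<open>Y\<close> serves on the codomains.\<close>

lemma retract_of_lift:
  assumes i: "i \<in> hom C X Z" and p: "p \<in> hom C Z Y" and lift: "has_lifts C i (p \<cdot> i)"
  shows "is_retract C (p \<cdot> i) p"
proof -
  have f: "p \<cdot> i \<in> hom C X Y" by (rule Comp_in_hom[OF i p])
  have X: "Id C X \<in> hom C X X" and Y: "Id C Y \<in> hom C Y Y"
    using Id_in_hom homD f by auto
  obtain h where h: "h \<in> hom C Z X" "h \<cdot> i = Id C X" "(p \<cdot> i) \<cdot> h = p"
    using has_liftsD[OF lift i f X p] Id_right[OF f] by blast
  show ?thesis
    unfolding is_retract_def using i p f X Y h Id_left[OF f] Id_left[OF p] Id_left[OF Y]
    by (intro conjI exI[of _ i] exI[of _ h] exI[of _ "Id C Y"]) (auto simp: hom_def)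
qed

text \<open>Here \<open>c\<close> is the base change of \<open>b\<close> along \<open>a\<close>.
  Lifting the composite square against \<open>b\<close> gives the component in \<open>Y\<close> of
  the required map; the other component is the bottom edge \<open>g\<close>.\<close>

lemma pullback_has_lifts:
  assumes a: "a \<in> hom C X Z" and b: "b \<in> hom C Y Z"
    and pb: "is_pullback C a b L c d"
    and i: "i \<in> hom C A B" and lift: "has_lifts C i b"
  shows "has_lifts C i c"
proof -
  have c: "c \<in> hom C L X" and d: "d \<in> hom C L Y" and sq: "a \<cdot> c = b \<cdot> d"
    and uni: "\<And>W x y. \<lbrakk>x \<in> hom C W X; y \<in> hom C W Y; a \<cdot> x = b \<cdot> y\<rbrakk> \<Longrightarrow>
        \<exists>!u. u \<in> hom C W L \<and> c \<cdot> u = x \<and> d \<cdot> u = y"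
    using pb a b unfolding is_pullback_def by (auto simp: hom_def)
  show ?thesis
  proof (rule has_liftsI[OF i c])
    fix f g assume f: "f \<in> hom C A L" and g: "g \<in> hom C B X" and fg: "c \<cdot> f = g \<cdot> i"
    have df: "d \<cdot> f \<in> hom C A Y" by (rule Comp_in_hom[OF f d])
    have ag: "a \<cdot> g \<in> hom C B Z" by (rule Comp_in_hom[OF g a])
    have "b \<cdot> (d \<cdot> f) = (a \<cdot> g) \<cdot> i"
      using Comp_assoc[OF f d b] Comp_assoc[OF f c a] Comp_assoc[OF i g a] sq fg by simp
    then obtain k where k: "k \<in> hom C B Y" "k \<cdot> i = d \<cdot> f" "b \<cdot> k = a \<cdot> g"
      using has_liftsD[OF lift i b df ag] by blast
    obtain u where u: "u \<in> hom C B L" "c \<cdot> u = g" "d \<cdot> u = k"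
      using uni[OF g k(1)] k(3) by auto
    have "a \<cdot> (c \<cdot> f) = b \<cdot> (d \<cdot> f)"
      using Comp_assoc[OF f d b] Comp_assoc[OF f c a] sq by simp
    \<comment> \<open>Both \<open>u \<cdot> i\<close> and \<open>f\<close> have the same two
      components, so uniqueness identifies them.\<close>
    from uni[OF Comp_in_hom[OF f c] df this]
    have "u \<cdot> i = f"
      using f Comp_in_hom[OF i u(1)] Comp_assoc[OF i u(1) c] Comp_assoc[OF i u(1) d] u fg k
      by auto
    with u show "\<exists>h \<in> hom C B L. h \<cdot> i = f \<and> c \<cdot> h = g" by blast
  qed
qed

end

section \<open>Lifting characterizations, fibrant objects and path objects\<close>

context closed_model_category
begin

text \<open>Factor \<open>f\<close> into a trivial cofibration and a fibration. Lifting the first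
  factor against \<open>f\<close> exhibits \<open>f\<close> as a retract of the second.\<close>

lemma Fib_if_has_lifts:
  assumes f: "f \<in> hom M X Y" and "\<And>i. \<lbrakk>i \<in> Cof M; i \<in> Weq M\<rbrakk> \<Longrightarrow> has_lifts M i f"
  shows "f \<in> Fib M"
proof -
  obtain Z i p where i: "i \<in> hom M X Z" "i \<in> Cof M" "i \<in> Weq M"
    and p: "p \<in> hom M Z Y" "p \<in> Fib M" and fpi: "f = p \<cdot> i"
    using CM5_trivial_Cof[OF f] by auto
  have "is_retract M f p"
    using retract_of_lift[OF i(1) p(1)] assms(2)[OF i(2,3)] fpi by simp
  then show ?thesis using CM3_Fib p(2) by blast
qed

text \<open>The same retract argument, now with the factorization into a cofibration and a trivial
  fibration.\<close>

lemma trivial_Fib_if_has_lifts: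
  assumes f: "f \<in> hom M X Y" and "\<And>i. i \<in> Cof M \<Longrightarrow> has_lifts M i f"
  shows "f \<in> Fib M \<and> f \<in> Weq M"
proof -
  obtain Z i p where i: "i \<in> hom M X Z" "i \<in> Cof M"
    and p: "p \<in> hom M Z Y" "p \<in> Fib M" "p \<in> Weq M" and fpi: "f = p \<cdot> i"
    using CM5_trivial_Fib[OF f] by auto
  have "is_retract M f p"
    using retract_of_lift[OF i(1) p(1)] assms(2)[OF i(2)] fpi by simp
  then show ?thesis using CM3_Fib CM3_Weq p by blast
qed

text \<open>Lift against the fibration from \<open>X\<close> to a terminal object; the square
  commutes by terminality.\<close>

lemma fibrant_extend:
  assumes X: "fibrant M X" and i: "i \<in> hom M A B" "i \<in> Cof M" "i \<in> Weq M"
    and f: "f \<in> hom M A X"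
  shows "\<exists>h \<in> hom M B X. h \<cdot> i = f"
proof -
  obtain T t where T: "is_terminal M T" and t: "t \<in> hom M X T" "t \<in> Fib M"
    using X unfolding fibrant_def by blast
  obtain g where g: "g \<in> hom M B T"
    using T homD[OF i(1)] unfolding is_terminal_def by blast
  have "t \<cdot> f = g \<cdot> i"
    using T Comp_in_hom[OF f t(1)] Comp_in_hom[OF i(1) g] homD[OF i(1)]
    unfolding is_terminal_def by blast
  then show ?thesis
    using has_liftsD[OF CM4_trivial_Cof[OF i(2,3) t(2)] i(1) t(1) f g] by blast
qed

text \<open>Factor the identity as \<open>p \<cdot> i\<close> with \<open>i\<close> a weak
  equivalence. It is then a retract of \<open>i\<close>, with \<open>i\<close> and \<open>p\<close>
  as the maps between the codomains.\<close>

lemma Id_in_Weq: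
  assumes "X \<in> Obj M"
  shows "Id M X \<in> Weq M"
proof -
  have I: "Id M X \<in> hom M X X" by (rule Id_in_hom[OF assms])
  obtain Z i p where ip: "i \<in> hom M X Z" "p \<in> hom M Z X" "i \<in> Weq M" "Id M X = p \<cdot> i"
    using CM5_trivial_Cof[OF I] by blast
  then have "is_retract M (Id M X) i"
    using I Id_left[OF I] Id_right[OF ip(1)] Id_right[OF I]
      Id_left[OF ip(2)] Id_right[OF ip(2)] unfolding is_retract_def
    by (intro conjI exI[of _ "Id M X"] exI[of _ i] exI[of _ p]) (auto simp: hom_def)
  then show ?thesis using ip CM3_Weq by blast
qed

text \<open>Right HELP quantifies over path objects, so drawing a conclusion from it requires one to
  exist. Factor the diagonal by CM5.\<close>

lemma path_object_exists:
  assumes Y: "fibrant M Y"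
  shows "\<exists>P q\<^sub>0 q\<^sub>1 YI j \<pi>. path_object M Y P q\<^sub>0 q\<^sub>1 YI j \<pi>"
proof -
  have Yo: "Y \<in> Obj M" using Y by (simp add: fibrant_def)
  \<comment> \<open>Fibrancy of \<open>Y\<close> supplies the terminal object over which the product
    is built.\<close>
  obtain P q\<^sub>0 q\<^sub>1 where P: "is_product M Y Y P q\<^sub>0 q\<^sub>1"
    using product_exists[OF CM1_limits _ Yo Yo] Y unfolding fibrant_def by blast
  obtain YI j \<pi> where "j \<in> hom M Y YI" "\<pi> \<in> hom M YI P" "j \<in> Weq M" "\<pi> \<in> Fib M"
    "pairing M P q\<^sub>0 q\<^sub>1 (Id M Y) (Id M Y) = \<pi> \<cdot> j"
    using CM5_trivial_Cof[OF pairing_props(1)[OF P Id_in_hom[OF Yo] Id_in_hom[OF Yo]]] by auto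
  then have "path_object M Y P q\<^sub>0 q\<^sub>1 YI j \<pi>"
    using P by (simp add: path_object_def)
  then show ?thesis by blast
qed

end

section \<open>The mapping path object\<close>

text \<open>The composites \<open>q\<^sub>0 \<cdot> \<pi>\<close> and
  \<open>q\<^sub>1 \<cdot> \<pi>\<close> evaluate a path at its start and its end. Thus
  \<open>N\<close> parametrizes points of \<open>X\<close> together with a path in \<open>Y\<close>
  starting at their image.\<close>

locale mapping_path_object = closed_model_category M
  for M :: "('o, 'm, 'x) model_category_scheme" (structure) +
  fixes X Y p P q\<^sub>0 q\<^sub>1 YI j \<pi> N c d
  assumes p: "p \<in> hom M X Y" and Y: "fibrant M Y"
    and path: "path_object M Y P q\<^sub>0 q\<^sub>1 YI j \<pi>"
    and pb: "is_pullback M p (q\<^sub>0 \<cdot> \<pi>) N c d"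
begin

lemma P: "is_product M Y Y P q\<^sub>0 q\<^sub>1"
  and j: "j \<in> hom M Y YI" "j \<in> Weq M"
  and \<pi>: "\<pi> \<in> hom M YI P" "\<pi> \<in> Fib M"
  and \<pi>j: "\<pi> \<cdot> j = pairing M P q\<^sub>0 q\<^sub>1 (Id M Y) (Id M Y)"
  using path by (auto simp: path_object_def)

lemma q: "q\<^sub>0 \<in> hom M P Y" "q\<^sub>1 \<in> hom M P Y"
  using P by (auto simp: is_product_def)

lemma ev: "q\<^sub>0 \<cdot> \<pi> \<in> hom M YI Y" "q\<^sub>1 \<cdot> \<pi> \<in> hom M YI Y"
  using Comp_in_hom[OF \<pi>(1)] q by auto

lemma c: "c \<in> hom M N X" and d: "d \<in> hom M N YI" and pc: "p \<cdot> c = (q\<^sub>0 \<cdot> \<pi>) \<cdot> d"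
  using pb p ev by (auto simp: is_pullback_def hom_def)

lemma N_universal:
  assumes "x \<in> hom M W X" "y \<in> hom M W YI" "p \<cdot> x = (q\<^sub>0 \<cdot> \<pi>) \<cdot> y"
  shows "\<exists>!u. u \<in> hom M W N \<and> c \<cdot> u = x \<and> d \<cdot> u = y"
proof -
  have "Dom M p = X" "Dom M (q\<^sub>0 \<cdot> \<pi>) = YI"
    using p ev by (auto simp: hom_def)
  then show ?thesis using pb assms unfolding is_pullback_def by blast
qed

lemma N_ext:
  assumes u: "u \<in> hom M W N" and v: "v \<in> hom M W N" and "c \<cdot> u = c \<cdot> v" "d \<cdot> u = d \<cdot> v"
  shows "u = v"
proof -
  have "p \<cdot> (c \<cdot> u) = (q\<^sub>0 \<cdot> \<pi>) \<cdot> (d \<cdot> u)"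
    using Comp_assoc[OF u c p] Comp_assoc[OF u d ev(1)] pc by simp
  from N_universal[OF Comp_in_hom[OF u c] Comp_in_hom[OF u d] this] assms
  show ?thesis by auto
qed

text \<open>Maps into \<open>P\<close> are compared by components, which turns a homotopy into a
  path with prescribed start and end. That \<open>a\<close> and \<open>b\<close> are maps is then
  automatic.\<close>

lemma right_homotopy_iff:
  "right_homotopy M Y P q\<^sub>0 q\<^sub>1 YI \<pi> W a b h \<longleftrightarrow>
     h \<in> hom M W YI \<and> (q\<^sub>0 \<cdot> \<pi>) \<cdot> h = a \<and> (q\<^sub>1 \<cdot> \<pi>) \<cdot> h = b"
proof (cases "h \<in> hom M W YI")
  case h: True
  have ab: "(q\<^sub>0 \<cdot> \<pi>) \<cdot> h \<in> hom M W Y" "(q\<^sub>1 \<cdot> \<pi>) \<cdot> h \<in> hom M W Y"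
    using Comp_in_hom[OF h] ev by auto
  show ?thesis
    using ab h eq_pairing_iff[OF P _ _ Comp_in_hom[OF h \<pi>(1)], of a b]
      Comp_assoc[OF h \<pi>(1)] q unfolding right_homotopy_def by auto
qed (simp add: right_homotopy_def)

lemma j_ev: "(q\<^sub>0 \<cdot> \<pi>) \<cdot> j = Id M Y" "(q\<^sub>1 \<cdot> \<pi>) \<cdot> j = Id M Y"
proof -
  have I: "Id M Y \<in> hom M Y Y" using Id_in_hom homD p by blast
  have "right_homotopy M Y P q\<^sub>0 q\<^sub>1 YI \<pi> Y (Id M Y) (Id M Y) j"
    using I j \<pi>j by (simp add: right_homotopy_def)
  then show "(q\<^sub>0 \<cdot> \<pi>) \<cdot> j = Id M Y" "(q\<^sub>1 \<cdot> \<pi>) \<cdot> j = Id M Y"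
    by (auto simp: right_homotopy_iff)
qed

text \<open>Extends a family of paths along a trivial cofibration with both ends prescribed, by
  lifting against the fibration \<open>\<pi>\<close> with the pairing of \<open>a\<close> and
  \<open>b\<close> as bottom edge.\<close>

lemma lift_path:
  assumes i: "i \<in> hom M A B" "i \<in> Cof M" "i \<in> Weq M"
    and y: "y \<in> hom M A YI" and ab: "a \<in> hom M B Y" "b \<in> hom M B Y"
    and ai: "(q\<^sub>0 \<cdot> \<pi>) \<cdot> y = a \<cdot> i" and bi: "(q\<^sub>1 \<cdot> \<pi>) \<cdot> y = b \<cdot> i"
  shows "\<exists>h \<in> hom M B YI. h \<cdot> i = y \<and> (q\<^sub>0 \<cdot> \<pi>) \<cdot> h = a \<and> (q\<^sub>1 \<cdot> \<pi>) \<cdot> h = b"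
proof -
  let ?u = "pairing M P q\<^sub>0 q\<^sub>1 a b"
  note u = pairing_props[OF P ab]
  have "right_homotopy M Y P q\<^sub>0 q\<^sub>1 YI \<pi> A (a \<cdot> i) (b \<cdot> i) y"
    using y ai bi by (simp add: right_homotopy_iff)
  then have "\<pi> \<cdot> y = pairing M P q\<^sub>0 q\<^sub>1 (a \<cdot> i) (b \<cdot> i)"
    by (simp add: right_homotopy_def)
  also have "\<dots> = ?u \<cdot> i"
    using eq_pairing_iff[OF P Comp_in_hom[OF i(1) ab(1)] Comp_in_hom[OF i(1) ab(2)]
        Comp_in_hom[OF i(1) u(1)]] Comp_assoc[OF i(1) u(1) q(1)] Comp_assoc[OF i(1) u(1) q(2)] u by auto
  finally obtain h where h: "h \<in> hom M B YI" "h \<cdot> i = y" "\<pi> \<cdot> h = ?u"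
    using has_liftsD[OF CM4_trivial_Cof[OF i(2,3) \<pi>(2)] i(1) \<pi>(1) y u(1)] by blast
  then have "right_homotopy M Y P q\<^sub>0 q\<^sub>1 YI \<pi> B a b h"
    using ab by (simp add: right_homotopy_def)
  then show ?thesis using h by (auto simp: right_homotopy_iff)
qed

text \<open>Two out of three applies because constant paths split the evaluation. For the fibration
  property, a square against it leaves the end of the path free.\<close>

lemma ev0_trivial_Fib: "q\<^sub>0 \<cdot> \<pi> \<in> Fib M" "q\<^sub>0 \<cdot> \<pi> \<in> Weq M"
proof -
  have "q\<^sub>0 \<cdot> \<pi> \<in> Weq M"
    using CM2_left[OF j(1) ev(1) j(2)] j_ev Id_in_Weq homD p by auto
  moreover have "q\<^sub>0 \<cdot> \<pi> \<in> Fib M"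
  proof (rule Fib_if_has_lifts[OF ev(1)])
    fix i assume i: "i \<in> Cof M" "i \<in> Weq M"
    define A B where "A = Dom M i" and "B = Cod M i"
    have iAB: "i \<in> hom M A B"
      using i Cof_sub by (auto simp: A_def B_def hom_def)
    show "has_lifts M i (q\<^sub>0 \<cdot> \<pi>)"
    proof (rule has_liftsI[OF iAB ev(1)])
      fix f g assume f: "f \<in> hom M A YI" and g: "g \<in> hom M B Y" and fg: "(q\<^sub>0 \<cdot> \<pi>) \<cdot> f = g \<cdot> i"
      \<comment> \<open>Fibrancy of \<open>Y\<close> extends the free end over \<open>B\<close>;
        then both ends are prescribed.\<close>
      obtain b where b: "b \<in> hom M B Y" "b \<cdot> i = (q\<^sub>1 \<cdot> \<pi>) \<cdot> f"
        using fibrant_extend[OF Y iAB i Comp_in_hom[OF f ev(2)]] by blast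
      show "\<exists>h \<in> hom M B YI. h \<cdot> i = f \<and> (q\<^sub>0 \<cdot> \<pi>) \<cdot> h = g"
        using lift_path[OF iAB i f g b(1) fg] b(2) by auto
    qed
  qed
  ultimately show "q\<^sub>0 \<cdot> \<pi> \<in> Fib M" "q\<^sub>0 \<cdot> \<pi> \<in> Weq M" by auto
qed

text \<open>As base change of the trivial fibration \<open>q\<^sub>0 \<cdot> \<pi>\<close>, the map
  \<open>c\<close> inherits lifts against all cofibrations, which forces it to be a trivial
  fibration.\<close>

lemma c_Weq: "c \<in> Weq M"
proof -
  have "has_lifts M i c" if i: "i \<in> Cof M" for i
  proof (rule pullback_has_lifts[OF p ev(1) pb])
    show "i \<in> hom M (Dom M i) (Cod M i)"
      using i Cof_sub by (auto simp: hom_def)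
    show "has_lifts M i (q\<^sub>0 \<cdot> \<pi>)"
      by (rule CM4_trivial_Fib[OF i ev0_trivial_Fib])
  qed
  then show ?thesis using trivial_Fib_if_has_lifts[OF c] by blast
qed

text \<open>This is the map \<open>r : N \<rightarrow> Y\<close> of the overview.\<close>

definition endpoint where "endpoint = (q\<^sub>1 \<cdot> \<pi>) \<cdot> d"

lemma endpoint: "endpoint \<in> hom M N Y"
  unfolding endpoint_def by (rule Comp_in_hom[OF d ev(2)])

lemma Weq_iff_endpoint: "p \<in> Weq M \<longleftrightarrow> endpoint \<in> Weq M"
proof -
  have X: "X \<in> Obj M" using homD p by blast
  have I: "Id M X \<in> hom M X X" by (rule Id_in_hom[OF X])
  have jp: "j \<cdot> p \<in> hom M X YI" by (rule Comp_in_hom[OF p j(1)])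
  \<comment> \<open>The section \<open>s\<close> pairs a point with the constant path at its image,
    given by \<open>j \<cdot> p\<close>.\<close>
  have "p \<cdot> Id M X = (q\<^sub>0 \<cdot> \<pi>) \<cdot> (j \<cdot> p)"
    using Comp_assoc[OF p j(1) ev(1)] j_ev Id_left[OF p] Id_right[OF p] by simp
  then obtain s where s: "s \<in> hom M X N" "c \<cdot> s = Id M X" "d \<cdot> s = j \<cdot> p"
    using N_universal[OF I jp] by blast
  have "s \<in> Weq M"
    using CM2_right[OF s(1) c c_Weq] s Id_in_Weq[OF X] by simp
  moreover have "endpoint \<cdot> s = p"
    unfolding endpoint_def
    using Comp_assoc[OF s(1) d ev(2)] Comp_assoc[OF p j(1) ev(2)] s j_ev Id_left[OF p] by simp
  ultimately show ?thesis
    using CM2_left[OF s(1) endpoint] CM2_comp[OF s(1) endpoint] by auto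
qed

text \<open>Conceptually, \<open>N \<rightarrow> X \<times> Y\<close> is a base change of
  \<open>\<pi>\<close>, and \<open>X \<times> Y \<rightarrow> Y\<close> is a fibration for fibrant
  \<open>X\<close>. The two lifting problems are solved in succession.\<close>

lemma endpoint_Fib:
  assumes X: "fibrant M X"
  shows "endpoint \<in> Fib M"
proof (rule Fib_if_has_lifts[OF endpoint])
  fix i assume i: "i \<in> Cof M" "i \<in> Weq M"
  define A B where "A = Dom M i" and "B = Cod M i"
  have iAB: "i \<in> hom M A B"
    using i Cof_sub by (auto simp: A_def B_def hom_def)
  show "has_lifts M i endpoint"
  proof (rule has_liftsI[OF iAB endpoint])
    fix f g assume f: "f \<in> hom M A N" and g: "g \<in> hom M B Y" and fg: "endpoint \<cdot> f = g \<cdot> i"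
    \<comment> \<open>First the point of \<open>X\<close> is extended; afterwards the path is lifted
      with start \<open>p \<cdot> x\<close> and end \<open>g\<close>.\<close>
    obtain x where x: "x \<in> hom M B X" "x \<cdot> i = c \<cdot> f"
      using fibrant_extend[OF X iAB i Comp_in_hom[OF f c]] by blast
    have "(q\<^sub>0 \<cdot> \<pi>) \<cdot> (d \<cdot> f) = (p \<cdot> x) \<cdot> i"
      using Comp_assoc[OF f d ev(1)] Comp_assoc[OF f c p] Comp_assoc[OF iAB x(1) p] pc x by simp
    moreover have "(q\<^sub>1 \<cdot> \<pi>) \<cdot> (d \<cdot> f) = g \<cdot> i"
      using Comp_assoc[OF f d ev(2)] fg by (simp add: endpoint_def)
    ultimately obtain y where y: "y \<in> hom M B YI" "y \<cdot> i = d \<cdot> f"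
        "(q\<^sub>0 \<cdot> \<pi>) \<cdot> y = p \<cdot> x" "(q\<^sub>1 \<cdot> \<pi>) \<cdot> y = g"
      using lift_path[OF iAB i Comp_in_hom[OF f d] Comp_in_hom[OF x(1) p] g] by blast
    then obtain u where u: "u \<in> hom M B N" "c \<cdot> u = x" "d \<cdot> u = y"
      using N_universal[OF x(1) y(1)] by auto
    have "u \<cdot> i = f"
      using N_ext[OF Comp_in_hom[OF iAB u(1)] f]
        Comp_assoc[OF iAB u(1) c] Comp_assoc[OF iAB u(1) d] u x y by simp
    moreover have "endpoint \<cdot> u = g"
      using Comp_assoc[OF u(1) d ev(2)] u y by (simp add: endpoint_def)
    ultimately show "\<exists>h \<in> hom M B N. h \<cdot> i = f \<and> endpoint \<cdot> h = g" using u by blast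
  qed
qed

text \<open>The dictionary: a map into \<open>N\<close> is a pair of a map into \<open>X\<close> and
  a path starting at its image, and its composite with \<open>endpoint\<close> is the end of that
  path.\<close>

lemma has_lifts_endpoint_iff:
  assumes i: "i \<in> hom M A B"
  shows "has_lifts M i endpoint \<longleftrightarrow>
    (\<forall>f\<^sub>A g h\<^sub>A. f\<^sub>A \<in> hom M A X \<and> g \<in> hom M B Y \<and>
        right_homotopy M Y P q\<^sub>0 q\<^sub>1 YI \<pi> A (p \<cdot> f\<^sub>A) (g \<cdot> i) h\<^sub>A \<longrightarrow>
        (\<exists>f h. f \<in> hom M B X \<and> right_homotopy M Y P q\<^sub>0 q\<^sub>1 YI \<pi> B (p \<cdot> f) g h \<and>
               f \<cdot> i = f\<^sub>A \<and> h \<cdot> i = h\<^sub>A))"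
    (is "_ \<longleftrightarrow> ?HELP")
proof
  assume lift: "has_lifts M i endpoint"
  show ?HELP
    unfolding right_homotopy_iff
  proof (intro allI impI, elim conjE)
    fix fA g hA
    assume fA: "fA \<in> hom M A X" and g: "g \<in> hom M B Y" and hA: "hA \<in> hom M A YI"
      and h0: "(q\<^sub>0 \<cdot> \<pi>) \<cdot> hA = p \<cdot> fA" and h1: "(q\<^sub>1 \<cdot> \<pi>) \<cdot> hA = g \<cdot> i"
    obtain u where u: "u \<in> hom M A N" "c \<cdot> u = fA" "d \<cdot> u = hA"
      using N_universal[OF fA hA] h0 by auto
    have "endpoint \<cdot> u = g \<cdot> i"
      using Comp_assoc[OF u(1) d ev(2)] u h1 by (simp add: endpoint_def)
    then obtain v where v: "v \<in> hom M B N" "v \<cdot> i = u" "endpoint \<cdot> v = g"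
      using has_liftsD[OF lift i endpoint u(1) g] by blast
    show "\<exists>f h. f \<in> hom M B X \<and>
        (h \<in> hom M B YI \<and> (q\<^sub>0 \<cdot> \<pi>) \<cdot> h = p \<cdot> f \<and> (q\<^sub>1 \<cdot> \<pi>) \<cdot> h = g) \<and> f \<cdot> i = fA \<and> h \<cdot> i = hA"
      using Comp_in_hom[OF v(1) c] Comp_in_hom[OF v(1) d] u v pc
        Comp_assoc[OF v(1) d ev(1)] Comp_assoc[OF v(1) d ev(2)] Comp_assoc[OF v(1) c p]
        Comp_assoc[OF i v(1) c] Comp_assoc[OF i v(1) d]
      by (intro exI[of _ "c \<cdot> v"] exI[of _ "d \<cdot> v"]) (simp add: endpoint_def)
  qed
next
  assume H: ?HELP
  show "has_lifts M i endpoint"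
  proof (rule has_liftsI[OF i endpoint])
    fix u g assume u: "u \<in> hom M A N" and g: "g \<in> hom M B Y" and ug: "endpoint \<cdot> u = g \<cdot> i"
    have "c \<cdot> u \<in> hom M A X" "d \<cdot> u \<in> hom M A YI"
      "(q\<^sub>0 \<cdot> \<pi>) \<cdot> (d \<cdot> u) = p \<cdot> (c \<cdot> u)" "(q\<^sub>1 \<cdot> \<pi>) \<cdot> (d \<cdot> u) = g \<cdot> i"
      using Comp_in_hom[OF u c] Comp_in_hom[OF u d] Comp_assoc[OF u d ev(1)]
        Comp_assoc[OF u d ev(2)] Comp_assoc[OF u c p] pc ug by (simp_all add: endpoint_def)
    then obtain f h where f: "f \<in> hom M B X" "f \<cdot> i = c \<cdot> u"
      and h: "h \<in> hom M B YI" "(q\<^sub>0 \<cdot> \<pi>) \<cdot> h = p \<cdot> f" "(q\<^sub>1 \<cdot> \<pi>) \<cdot> h = g" "h \<cdot> i = d \<cdot> u"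
      using H g unfolding right_homotopy_iff by metis
    obtain v where v: "v \<in> hom M B N" "c \<cdot> v = f" "d \<cdot> v = h"
      using N_universal[OF f(1) h(1)] h(2) by auto
    have "v \<cdot> i = u"
      using N_ext[OF Comp_in_hom[OF i v(1)] u]
        Comp_assoc[OF i v(1) c] Comp_assoc[OF i v(1) d] f h v by simp
    moreover have "endpoint \<cdot> v = g"
      using Comp_assoc[OF v(1) d ev(2)] v h by (simp add: endpoint_def)
    ultimately show "\<exists>h \<in> hom M B N. h \<cdot> i = u \<and> endpoint \<cdot> h = g" using v by blast
  qed
qed

end

section \<open>Weak equivalences between fibrant objects\<close>

lemma (in closed_model_category) mapping_path_object_exists:
  assumes p: "p \<in> hom M X Y" and Y: "fibrant M Y" and path: "path_object M Y P q\<^sub>0 q\<^sub>1 YI j \<pi>"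
  shows "\<exists>N c d. mapping_path_object M X Y p P q\<^sub>0 q\<^sub>1 YI j \<pi> N c d"
proof -
  have "q\<^sub>0 \<cdot> \<pi> \<in> hom M YI Y"
    using path Comp_in_hom unfolding path_object_def is_product_def by blast
  then obtain N c d where "is_pullback M p (q\<^sub>0 \<cdot> \<pi>) N c d"
    using pullback_exists[OF CM1_limits p] by blast
  with p Y path have "mapping_path_object M X Y p P q\<^sub>0 q\<^sub>1 YI j \<pi> N c d"
    by unfold_locales
  then show ?thesis by blast
qed

theorem (in closed_model_category) Weq_iff_right_HELP:
  assumes p: "p \<in> hom M X Y" and X: "fibrant M X" and Y: "fibrant M Y"
  shows "p \<in> Weq M \<longleftrightarrow> (\<forall>i \<in> Cof M. right_HELP M p i)"
proof -
  have D: "Dom M p = X" "Cod M p = Y" using p by (auto simp: hom_def)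
  show ?thesis
  proof
    assume pW: "p \<in> Weq M"
    show "\<forall>i \<in> Cof M. right_HELP M p i"
    proof
      fix i assume i: "i \<in> Cof M"
      then have iAB: "i \<in> hom M (Dom M i) (Cod M i)"
        using Cof_sub by (auto simp: hom_def)
      show "right_HELP M p i"
        unfolding right_HELP_def Let_def D
      proof (intro allI impI, elim conjE)
        fix fA g P q\<^sub>0 q\<^sub>1 YI j \<pi> hA
        assume *: "fA \<in> hom M (Dom M i) X" "g \<in> hom M (Cod M i) Y"
          "right_homotopy M Y P q\<^sub>0 q\<^sub>1 YI \<pi> (Dom M i) (p \<cdot> fA) (g \<cdot> i) hA"
          and path: "path_object M Y P q\<^sub>0 q\<^sub>1 YI j \<pi>"
        \<comment> \<open>The extended homotopy must use the given path object, so \<open>N\<close>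
          is built from that one.\<close>
        obtain N c d where "mapping_path_object M X Y p P q\<^sub>0 q\<^sub>1 YI j \<pi> N c d"
          using mapping_path_object_exists[OF p Y path] by blast
        then interpret mapping_path_object M X Y p P q\<^sub>0 q\<^sub>1 YI j \<pi> N c d .
        have "endpoint \<in> Weq M" using pW Weq_iff_endpoint by blast
        then have "has_lifts M i endpoint"
          using CM4_trivial_Fib[OF i endpoint_Fib[OF X]] by blast
        then show "\<exists>f h. f \<in> hom M (Cod M i) X \<and>
            right_homotopy M Y P q\<^sub>0 q\<^sub>1 YI \<pi> (Cod M i) (p \<cdot> f) g h \<and> f \<cdot> i = fA \<and> h \<cdot> i = hA"
          using * has_lifts_endpoint_iff[OF iAB] by blast
      qed
    qed
  next
    assume H: "\<forall>i \<in> Cof M. right_HELP M p i"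
    \<comment> \<open>For this direction a single path object suffices.\<close>
    obtain P q\<^sub>0 q\<^sub>1 YI j \<pi> where path: "path_object M Y P q\<^sub>0 q\<^sub>1 YI j \<pi>"
      using path_object_exists[OF Y] by blast
    obtain N c d where "mapping_path_object M X Y p P q\<^sub>0 q\<^sub>1 YI j \<pi> N c d"
      using mapping_path_object_exists[OF p Y path] by blast
    then interpret mapping_path_object M X Y p P q\<^sub>0 q\<^sub>1 YI j \<pi> N c d .
    have "has_lifts M i endpoint" if i: "i \<in> Cof M" for i
    proof -
      have iAB: "i \<in> hom M (Dom M i) (Cod M i)"
        using i Cof_sub by (auto simp: hom_def)
      show ?thesis
        using H i path unfolding has_lifts_endpoint_iff[OF iAB] right_HELP_def Let_def D by blast
    qed
    then have "endpoint \<in> Weq M"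
      using trivial_Fib_if_has_lifts[OF endpoint] by blast
    then show "p \<in> Weq M" using Weq_iff_endpoint by blast
  qed
qed

section \<open>Duality\<close>

definition opposite :: "('o, 'm, 'x) category_scheme \<Rightarrow> ('o, 'm, 'x) category_scheme" where
  "opposite C = C\<lparr>Dom := Cod C, Cod := Dom C, Comp := (\<lambda>g f. f \<cdot>\<^bsub>C\<^esub> g)\<rparr>"

text \<open>Reversing arrows alone leaves \<open>Fib\<close> and \<open>Cof\<close> in place, so
  they are exchanged here. \<open>opposite\<close> stays separate because it also applies to diagram
  shapes.\<close>

definition dual :: "('o, 'm, 'x) model_category_scheme \<Rightarrow> ('o, 'm, 'x) model_category_scheme" where
  "dual M = (opposite M)\<lparr>Fib := Cof M, Cof := Fib M\<rparr>"

lemma opposite_simps [simp]: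
  "Obj (opposite C) = Obj C" "Mor (opposite C) = Mor C" "Id (opposite C) = Id C"
  "Dom (opposite C) = Cod C" "Cod (opposite C) = Dom C" "g \<cdot>\<^bsub>opposite C\<^esub> f = f \<cdot>\<^bsub>C\<^esub> g"
  by (simp_all add: opposite_def)

lemma dual_simps [simp]:
  "Obj (dual M) = Obj M" "Mor (dual M) = Mor M" "Id (dual M) = Id M"
  "Dom (dual M) = Cod M" "Cod (dual M) = Dom M" "g \<cdot>\<^bsub>dual M\<^esub> f = f \<cdot>\<^bsub>M\<^esub> g"
  "Fib (dual M) = Cof M" "Cof (dual M) = Fib M" "Weq (dual M) = Weq M"
  by (simp_all add: dual_def opposite_def)

lemma hom_dual [simp]: "hom (dual M) X Y = hom M Y X"
  by (auto simp: hom_def)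

lemma hom_opposite [simp]: "hom (opposite C) X Y = hom C Y X"
  by (auto simp: hom_def)

lemma (in category) category_opposite: "category (opposite C)"
  using Dom_in_Obj Cod_in_Obj Id_in_hom Comp_in_hom Id_right Id_left
  by unfold_locales (auto simp: Comp_assoc)

lemma opposite_opposite [simp]: "opposite (opposite C) = C"
  by (simp add: opposite_def)

lemma category_opposite_iff: "category (opposite C) \<longleftrightarrow> category C"
  using category.category_opposite[of C] category.category_opposite[of "opposite C"] by auto

lemma is_functor_opposite:
  "is_functor (opposite J) (opposite C) Fo Fm \<longleftrightarrow> is_functor J C Fo Fm"
  by (auto simp: is_functor_def category_opposite_iff)

lemma is_limit_opposite:
  "is_limit (opposite J) (opposite C) Fo Fm L c \<longleftrightarrow> is_colimit J C Fo Fm L c"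
  by (simp add: is_limit_def is_colimit_def is_cone_def is_cocone_def)

text \<open>A diagram of shape \<open>J\<close> in \<open>opposite C\<close> is a diagram of shape
  \<open>opposite J\<close> in \<open>C\<close>, and taking opposites preserves finiteness of
  shapes.\<close>

lemma has_finite_limits_opposite: "has_finite_limits (opposite C) \<longleftrightarrow> has_finite_colimits C"
  unfolding has_finite_limits_def has_finite_colimits_def
  by (metis is_functor_opposite is_limit_opposite opposite_opposite opposite_simps(1,2))

lemma has_finite_colimits_opposite: "has_finite_colimits (opposite C) \<longleftrightarrow> has_finite_limits C"
  by (metis has_finite_limits_opposite opposite_opposite)

text \<open>\<open>dual M\<close> and \<open>opposite M\<close> have the same underlying category
  and differ only in \<open>Fib\<close> and \<open>Cof\<close>, which functors do not see.\<close>

lemma is_functor_dual: "is_functor J (dual M) = is_functor J (opposite M)"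
  by (intro ext) (simp add: is_functor_def category_def)

lemma has_finite_limits_dual: "has_finite_limits (dual M) \<longleftrightarrow> has_finite_limits (opposite M)"
  by (simp add: has_finite_limits_def is_functor_dual is_limit_def is_cone_def)

lemma has_finite_colimits_dual: "has_finite_colimits (dual M) \<longleftrightarrow> has_finite_colimits (opposite M)"
  by (simp add: has_finite_colimits_def is_functor_dual is_colimit_def is_cocone_def)

lemma is_retract_dual:
  assumes "is_retract (dual M) f g"
  shows "is_retract M f g"
proof -
  obtain s0 r0 s1 r1 where
    "f \<in> Mor M" "g \<in> Mor M"
    "s0 \<in> hom M (Cod M g) (Cod M f)" "r0 \<in> hom M (Cod M f) (Cod M g)"
    "s1 \<in> hom M (Dom M g) (Dom M f)" "r1 \<in> hom M (Dom M f) (Dom M g)"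
    "s0 \<cdot>\<^bsub>M\<^esub> r0 = Id M (Cod M f)" "s1 \<cdot>\<^bsub>M\<^esub> r1 = Id M (Dom M f)"
    "s0 \<cdot>\<^bsub>M\<^esub> g = f \<cdot>\<^bsub>M\<^esub> s1" "r0 \<cdot>\<^bsub>M\<^esub> f = g \<cdot>\<^bsub>M\<^esub> r1"
    using assms by (auto simp: is_retract_def)
  then show ?thesis
    unfolding is_retract_def
    by (intro conjI exI[of _ r1] exI[of _ s1] exI[of _ r0] exI[of _ s0]) auto
qed

lemma has_lifts_dual: "has_lifts (dual M) i p \<longleftrightarrow> has_lifts M p i"
  unfolding has_lifts_def by (auto simp: eq_commute)

text \<open>Duality exchanges the two cancellation laws of CM2, the retract axioms for
  \<open>Fib\<close> and \<open>Cof\<close>, and the two halves each of CM1, CM4 and CM5.\<close>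

lemma (in closed_model_category) closed_model_category_dual: "closed_model_category (dual M)"
proof -
  interpret op: category "opposite M" by (rule category_opposite)
  have D: "category (dual M)"
    using op.category_axioms by (simp add: category_def)
  interpret op: category "dual M" by (rule D)
  show ?thesis
  proof
    show "Fib (dual M) \<subseteq> Mor (dual M)" "Cof (dual M) \<subseteq> Mor (dual M)"
      "Weq (dual M) \<subseteq> Mor (dual M)"
      using Fib_sub Cof_sub Weq_sub by auto
    show "has_finite_limits (dual M)" "has_finite_colimits (dual M)"
      using CM1_limits CM1_colimits
      by (simp_all add: has_finite_limits_dual has_finite_colimits_dual
          has_finite_limits_opposite has_finite_colimits_opposite)
  next
    fix f g X Y Z
    assume "f \<in> hom (dual M) X Y" "g \<in> hom (dual M) Y Z"
    then have f: "f \<in> hom M Y X" and g: "g \<in> hom M Z Y" by auto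
    show "g \<cdot>\<^bsub>dual M\<^esub> f \<in> Weq (dual M)" if "f \<in> Weq (dual M)" "g \<in> Weq (dual M)"
      using CM2_comp[OF g f] that by simp
    show "g \<in> Weq (dual M)" if "f \<in> Weq (dual M)" "g \<cdot>\<^bsub>dual M\<^esub> f \<in> Weq (dual M)"
      using CM2_right[OF g f] that by simp
    show "f \<in> Weq (dual M)" if "g \<in> Weq (dual M)" "g \<cdot>\<^bsub>dual M\<^esub> f \<in> Weq (dual M)"
      using CM2_left[OF g f] that by simp
  next
    fix f g assume r: "is_retract (dual M) f g"
    show "f \<in> Fib (dual M)" if "g \<in> Fib (dual M)"
      using CM3_Cof[OF is_retract_dual[OF r]] that by simp
    show "f \<in> Cof (dual M)" if "g \<in> Cof (dual M)"
      using CM3_Fib[OF is_retract_dual[OF r]] that by simp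
    show "f \<in> Weq (dual M)" if "g \<in> Weq (dual M)"
      using CM3_Weq[OF is_retract_dual[OF r]] that by simp
  next
    fix i p assume "i \<in> Cof (dual M)" "p \<in> Fib (dual M)"
    then have i: "i \<in> Fib M" and p: "p \<in> Cof M" by auto
    show "has_lifts (dual M) i p" if "i \<in> Weq (dual M)"
      using CM4_trivial_Fib[OF p i] that by (simp add: has_lifts_dual)
    show "has_lifts (dual M) i p" if "p \<in> Weq (dual M)"
      using CM4_trivial_Cof[OF p _ i] that by (simp add: has_lifts_dual)
  next
    fix f X Y assume "f \<in> hom (dual M) X Y"
    then have f: "f \<in> hom M Y X" by simp
    show "\<exists>Z. \<exists>i \<in> hom (dual M) X Z. \<exists>p \<in> hom (dual M) Z Y.
        i \<in> Cof (dual M) \<and> i \<in> Weq (dual M) \<and> p \<in> Fib (dual M) \<and> f = p \<cdot>\<^bsub>dual M\<^esub> i"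
      using CM5_trivial_Fib[OF f] by auto
    show "\<exists>Z. \<exists>i \<in> hom (dual M) X Z. \<exists>p \<in> hom (dual M) Z Y.
        i \<in> Cof (dual M) \<and> p \<in> Fib (dual M) \<and> p \<in> Weq (dual M) \<and> f = p \<cdot>\<^bsub>dual M\<^esub> i"
      using CM5_trivial_Cof[OF f] by auto
  qed
qed

section \<open>Duals of fibrancy, path objects, homotopies and HELP\<close>

lemma is_terminal_dual: "is_terminal (dual M) T \<longleftrightarrow> is_initial M T"
  by (simp add: is_terminal_def is_initial_def)

lemma fibrant_dual: "fibrant (dual M) X \<longleftrightarrow> cofibrant M X"
  by (simp add: fibrant_def cofibrant_def is_terminal_dual)

lemma pairing_dual: "pairing (dual M) = copairing M"
  by (intro ext) (simp add: pairing_def copairing_def)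

lemma is_product_dual: "is_product (dual M) X Y P q\<^sub>0 q\<^sub>1 \<longleftrightarrow> is_coproduct M X Y P q\<^sub>0 q\<^sub>1"
  by (simp add: is_product_def is_coproduct_def)

text \<open>The factors trade places: the weak equivalence into the path object becomes
  \<open>\<sigma>\<close>, and the fibration out of it becomes the cofibration
  \<open>j\<close>.\<close>

lemma path_object_dual:
  "path_object (dual M) A S e\<^sub>0 e\<^sub>1 Z \<sigma> j \<longleftrightarrow> cylinder_object M A S e\<^sub>0 e\<^sub>1 Z j \<sigma>"
  by (auto simp: path_object_def cylinder_object_def is_product_dual pairing_dual)

lemma right_homotopy_dual:
  "right_homotopy (dual M) A S e\<^sub>0 e\<^sub>1 Z j C a b h \<longleftrightarrow> left_homotopy M A S e\<^sub>0 e\<^sub>1 Z j C a b h"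
  by (simp add: right_homotopy_def left_homotopy_def pairing_dual)

text \<open>The data \<open>f\<^sub>A\<close> and \<open>g\<close> turn into
  \<open>g\<^sub>Y\<close> and \<open>f\<close>. The orientations of the homotopies already agree,
  so none has to be reversed.\<close>

lemma right_HELP_dual: "right_HELP (dual M) i p \<longleftrightarrow> left_HELP M i p"
  unfolding right_HELP_def left_HELP_def Let_def
  by (simp add: path_object_dual right_homotopy_dual) blast

theorem (in closed_model_category) Weq_iff_left_HELP:
  assumes i: "i \<in> hom M A B" and A: "cofibrant M A" and B: "cofibrant M B"
  shows "i \<in> Weq M \<longleftrightarrow> (\<forall>p \<in> Fib M. left_HELP M i p)"
  using closed_model_category.Weq_iff_right_HELP[OF closed_model_category_dual, of i B A] assms
  by (simp add: fibrant_dual right_HELP_dual)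

theorem mainTheorem1:
  fixes M :: "('o, 'm) model_category"
  assumes "closed_model_category M"
  shows "(\<forall>X Y p. p \<in> hom M X Y \<and> fibrant M X \<and> fibrant M Y \<longrightarrow>
            (p \<in> Weq M \<longleftrightarrow> (\<forall>i \<in> Cof M. right_HELP M p i)))
       \<and> (\<forall>A B i. i \<in> hom M A B \<and> cofibrant M A \<and> cofibrant M B \<longrightarrow>
            (i \<in> Weq M \<longleftrightarrow> (\<forall>p \<in> Fib M. left_HELP M i p)))"
  using closed_model_category.Weq_iff_right_HELP[OF assms]
    closed_model_category.Weq_iff_left_HELP[OF assms] by blast

end
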